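(* Let $p=2\text{-}13$ (generalized pattern). For integers $k,\ell\ge 1$ put $m=\max(k,\ell)$. Then: (i) $\displaystyle G_{p}^{12\ldots k,\,12\ldots \ell}(x) = x^{k+\ell-1}C^{k+1}(x)+\frac{x^m-x^{k+\ell-1}}{1-x}$. (ii) $\displaystyle G_{p}^{k(k-1)\ldots 1,\,12\ldots \ell}(x) = x^{k+\ell-1}C^2(x)$. (iii) $\displaystyle G_{p}^{k(k-1)\ldots 1,\,\ell(\ell-1)\ldots 1}(x) = x^{k+\ell-1}C^{\ell+1}(x)+\frac{x^m-x^{k+\ell-1}}{1-x}$. (iv) The generating function $\displaystyle G_p(x,y,z)=\sum_{k,\ell\geq0}G_{p}^{12\ldots k,\,\ell(\ell-1)\ldots 1}(x)\,y^kz^{\ell}$ equals $$\frac{1}{1-x(y+z)}\left( x(y+z+yz) +\frac{C(x)-1}{(1-xyC(x))(1-xzC(x))}\right).$$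
   Context: A permutation $\pi=\pi_1\cdots\pi_n$ of $\{1,\dots,n\}$ avoids the generalized pattern $2\text{-}13$ if there are no indices $a<b$ with $b+1\le n$ and $\pi_b<\pi_a<\pi_{b+1}$ (absence of a dash means the two corresponding letters must be adjacent in $\pi$). It begins with the pattern $12\ldots k$ (respectively $k(k-1)\ldots1$) if $n\ge k$ and $\pi_1<\cdots<\pi_k$ (respectively $\pi_1>\cdots>\pi_k$); it ends with the pattern $12\ldots\ell$ (respectively $\ell(\ell-1)\ldots 1$) if $n\ge\ell$ and $\pi_{n-\ell+1}<\cdots<\pi_n$ (respectively $\pi_{n-\ell+1}>\cdots>\pi_n$). The initial and final segments are allowed to overlap. $G_p^{q,r}(x)=\sum_{n\ge1}N_p^{q,r}(n)x^n$, where $N_p^{q,r}(n)$ is the number of permutations of $\{1,\dots,n\}$ that avoid $p$, begin with $q$ and end with $r$ (the empty permutation is not counted). For $k=0$ (respectively $\ell=0$) no condition is imposed on the beginning (respectively the end) of the permutation. $C(x)=\sum_{n\ge0}C_nx^n=\frac{1-\sqrt{1-4x}}{2x}$ is the generating function of the Catalan numbers, and $C^j(x)=(C(x))^j$. *)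

theory Defs
  imports
    "HOL-Computational_Algebra.Formal_Power_Series"
    "HOL-Combinatorics.Permutations"
begin

unbundle fps_syntax

section \<open>Generalized patterns in permutations\<close>

text \<open>
  A permutation \<open>\<pi>\<^sub>1 \<dots> \<pi>\<^sub>n\<close> of \<open>{1..n}\<close> is a function \<open>\<pi>\<close> with \<open>\<pi> permutes {1..n}\<close>.
  Properties of permutations take the length \<open>n\<close> as their first argument.
\<close>

definition avoids_2_13 :: "nat \<Rightarrow> (nat \<Rightarrow> nat) \<Rightarrow> bool" where
  "avoids_2_13 n \<pi> \<longleftrightarrow>
     \<not> (\<exists>a b. 1 \<le> a \<and> a < b \<and> b + 1 \<le> n \<and> \<pi> b < \<pi> a \<and> \<pi> a < \<pi> (b + 1))"

definition begins_incr :: "nat \<Rightarrow> nat \<Rightarrow> (nat \<Rightarrow> nat) \<Rightarrow> bool" where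
  "begins_incr k n \<pi> \<longleftrightarrow> k \<le> n \<and> strict_mono_on {1..k} \<pi>"

definition begins_decr :: "nat \<Rightarrow> nat \<Rightarrow> (nat \<Rightarrow> nat) \<Rightarrow> bool" where
  "begins_decr k n \<pi> \<longleftrightarrow> k \<le> n \<and> strict_antimono_on {1..k} \<pi>"

definition ends_incr :: "nat \<Rightarrow> nat \<Rightarrow> (nat \<Rightarrow> nat) \<Rightarrow> bool" where
  "ends_incr l n \<pi> \<longleftrightarrow> l \<le> n \<and> strict_mono_on {n - l + 1..n} \<pi>"

definition ends_decr :: "nat \<Rightarrow> nat \<Rightarrow> (nat \<Rightarrow> nat) \<Rightarrow> bool" where
  "ends_decr l n \<pi> \<longleftrightarrow> l \<le> n \<and> strict_antimono_on {n - l + 1..n} \<pi>"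

definition perm_count ::
  "(nat \<Rightarrow> (nat \<Rightarrow> nat) \<Rightarrow> bool) \<Rightarrow> (nat \<Rightarrow> (nat \<Rightarrow> nat) \<Rightarrow> bool) \<Rightarrow>
   (nat \<Rightarrow> (nat \<Rightarrow> nat) \<Rightarrow> bool) \<Rightarrow> nat \<Rightarrow> nat" where
  "perm_count p q r n = card {\<pi>. \<pi> permutes {1..n} \<and> p n \<pi> \<and> q n \<pi> \<and> r n \<pi>}"

definition perm_gf ::
  "(nat \<Rightarrow> (nat \<Rightarrow> nat) \<Rightarrow> bool) \<Rightarrow> (nat \<Rightarrow> (nat \<Rightarrow> nat) \<Rightarrow> bool) \<Rightarrow>
   (nat \<Rightarrow> (nat \<Rightarrow> nat) \<Rightarrow> bool) \<Rightarrow> rat fps" where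
  "perm_gf p q r = Abs_fps (\<lambda>n. if n = 0 then 0 else of_nat (perm_count p q r n))"


section \<open>The Catalan generating function\<close>

definition catalan_gf :: "rat fps" where
  "catalan_gf = Abs_fps (\<lambda>n. of_nat ((2 * n) choose n) / of_nat (n + 1))"

lemma catalan_gf_Suc:
  "of_nat (n + 2) * catalan_gf $ Suc n = of_nat (4 * n + 2) * catalan_gf $ n"
proof -
  let ?b = "\<lambda>m. of_nat ((2 * m) choose m) :: rat"
  have b: "?b m = fact (2 * m) / (fact m * fact m)" for m
    using binomial_fact[of m "2 * m", where ?'a = rat] by (simp add: mult_2)
  have f: "(fact (2 * Suc n) :: rat) =
      of_nat (2 * n + 2) * (of_nat (2 * n + 1) * fact (2 * n))"
    by (simp add: algebra_simps)
  have "of_nat (n + 1) * ?b (Suc n) = of_nat (4 * n + 2) * ?b n"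
    unfolding b f by (simp add: field_simps del: of_nat_Suc) (simp add: algebra_simps)
  then show ?thesis
    unfolding catalan_gf_def by (simp add: field_simps del: binomial_Suc_Suc)
qed

text \<open>The closed form \<open>C(x) = (1 - \<surd>(1 - 4x)) / (2x)\<close>.\<close>

lemma catalan_gf_closed_form: "(1 - 2 * fps_X * catalan_gf)\<^sup>2 = 1 - 4 * fps_X"
proof -
  define S where "S = 1 - 2 * fps_X * catalan_gf"
  have nth_numeral: "(numeral w * f) $ n = numeral w * f $ n" for w n and f :: "rat fps"
    by (simp add: numeral_fps_const)
  have S0: "S $ 0 = 1"
    by (simp add: S_def mult.assoc nth_numeral)
  have SS: "S $ Suc n = - 2 * catalan_gf $ n" for n
    by (simp add: S_def mult.assoc nth_numeral)
  have C0: "catalan_gf $ 0 = 1"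
    by (simp add: catalan_gf_def)
  have dS: "fps_deriv S = 4 * (fps_X * fps_deriv S) - 2 * S"
  proof (rule fps_ext)
    fix n
    show "fps_deriv S $ n = (4 * (fps_X * fps_deriv S) - 2 * S) $ n"
    proof (cases n)
      case 0
      then show ?thesis
        by (simp add: nth_numeral S0 SS[of 0, simplified] C0)
    next
      case (Suc m)
      then show ?thesis
        using catalan_gf_Suc[of m] by (simp add: nth_numeral SS) (simp add: algebra_simps)
    qed
  qed
  define T where "T = S\<^sup>2"
  have "fps_deriv T = 2 * S * fps_deriv S"
    by (simp add: T_def power2_eq_square algebra_simps)
  also have "\<dots> = 2 * S * (4 * (fps_X * fps_deriv S) - 2 * S)"
    using dS by simp
  also have "\<dots> = 4 * (fps_X * (2 * S * fps_deriv S)) - 4 * T"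
    by (simp add: T_def power2_eq_square algebra_simps)
  also have "2 * S * fps_deriv S = fps_deriv T"
    by (simp add: T_def power2_eq_square algebra_simps)
  finally have dT: "fps_deriv T = 4 * (fps_X * fps_deriv T) - 4 * T" .
  have T0: "T $ 0 = 1"
    by (simp add: T_def power2_eq_square S0)
  have T1: "T $ 1 = - 4"
    using arg_cong[OF dT, of "\<lambda>f. f $ 0"] by (simp add: nth_numeral T0)
  have T2: "T $ Suc (Suc n) = 0" for n
  proof (induction n)
    case 0
    show ?case
      using arg_cong[OF dT, of "\<lambda>f. f $ 1"] T1 by (simp add: numeral_fps_const)
  next
    case (Suc n)
    have "of_nat (n + 3) * T $ Suc (Suc (Suc n)) = 0"
      using arg_cong[OF dT, of "\<lambda>f. f $ Suc (Suc n)"] Suc by (simp add: nth_numeral)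
    then show ?case
      by (simp del: of_nat_add)
  qed
  have "T = 1 - 4 * fps_X"
  proof (rule fps_ext)
    fix n
    consider "n = 0" | "n = 1" | m where "n = Suc (Suc m)"
      by (metis One_nat_def not0_implies_Suc)
    then show "T $ n = (1 - 4 * fps_X) $ n"
      by cases (simp_all add: T0 T1[simplified] T2 numeral_fps_const)
  qed
  then show ?thesis
    by (simp add: T_def S_def)
qed


section \<open>Power series in three variables\<close>

text \<open>
  \<open>\<rat>[[x,y,z]]\<close> is represented as \<open>rat fps fps fps\<close>: the outermost variable is \<open>y\<close>, the middle
  one \<open>z\<close>, the innermost one \<open>x\<close>. Thus \<open>f $ k $ l $ n\<close> is the coefficient of \<open>y\<^sup>k z\<^sup>l x\<^sup>n\<close>.
\<close>

type_synonym fps_xyz = "rat fps fps fps"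

definition in_x :: "rat fps \<Rightarrow> fps_xyz" where
  "in_x f = fps_const (fps_const f)"

definition var_x :: fps_xyz where "var_x = in_x fps_X"
definition var_y :: fps_xyz where "var_y = fps_X"
definition var_z :: fps_xyz where "var_z = fps_const fps_X"

text \<open>
  The coefficients of a \<open>fps_xyz\<close> do not form a field, so the library lemmas on division of
  power series do not all apply. The following shows that \<open>/\<close> is nevertheless true division
  whenever the denominator has a nonzero constant term.
\<close>

lemma fps_xyz_divide_mult_cancel:
  fixes f g :: fps_xyz
  assumes "g $ 0 $ 0 $ 0 \<noteq> 0"
  shows "f / g * g = f"
proof -
  have 1: "g $ 0 $ 0 * inverse (g $ 0 $ 0) = 1"
    using assms by (simp add: inverse_mult_eq_1')
  have 2: "g $ 0 * inverse (g $ 0) = 1"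
    using fps_right_inverse[OF 1] by (simp only: fps_inverse_def[of "g $ 0"])
  have 3: "g * inverse g = 1"
    using fps_right_inverse[OF 2] by (simp only: fps_inverse_def[of g])
  have "g $ 0 \<noteq> 0"
    using assms by auto
  then have "f / g = f * inverse g"
    by (rule fps_divide_unit)
  then show ?thesis
    using 3 by (simp add: mult.assoc mult.commute)
qed

definition perm_gf_xyz :: "(nat \<Rightarrow> (nat \<Rightarrow> nat) \<Rightarrow> bool) \<Rightarrow> fps_xyz" where
  "perm_gf_xyz p = Abs_fps (\<lambda>k. Abs_fps (\<lambda>l. perm_gf p (begins_incr k) (ends_decr l)))"

end

theory Submission imports Defs
begin

text \<open>
  Let \<open>a\<close> be the first letter of a permutation. If the permutation avoids \<open>2-13\<close>, no two adjacent
  later letters go from below \<open>a\<close> to above \<open>a\<close>, so all letters above \<open>a\<close> come before all letters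
  below \<open>a\<close>: the permutation is \<open>a U V\<close> with \<open>U > a > V\<close>. Conversely \<open>a U V\<close> avoids the pattern as
  soon as \<open>U\<close> and \<open>V\<close> do, since a letter of \<open>U\<close> exceeds everything in \<open>V\<close>. Iterating this gives
  a bijection with binary trees in which the root has subtrees for \<open>U\<close> and \<open>V\<close>, whence the Catalan
  series.

  All four conditions can be read off the two subtrees, because the descent from \<open>U\<close> (or from \<open>a\<close>)
  to \<open>V\<close> stops every increasing run:
  \<^item> \<open>a U V\<close> starts with \<open>k + 1\<close> ascending letters iff \<open>U\<close> starts with \<open>k\<close> of them;
  \<^item> it starts with \<open>k + 2\<close> descending letters iff \<open>U\<close> is empty and \<open>V\<close> starts with \<open>k + 1\<close> of them;
  \<^item> it ends with \<open>l + 1\<close> ascending letters iff \<open>V\<close> does, or \<open>V\<close> is empty and \<open>a U\<close> does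
    (\<open>Node_in_asc_end\<close>);
  \<^item> it ends with \<open>l + 1\<close> descending letters iff \<open>V\<close> does, or \<open>V\<close> is wholly descending, of length
    \<open>s \<le> l\<close>, and \<open>a U\<close> ends with \<open>l + 1 - s\<close> of them (\<open>Node_in_desc_end\<close>).

  Each set of trees in question is therefore a disjoint union of sets of the form ``one subtree from
  \<open>A\<close>, the other from \<open>B\<close>'', up to a single wholly monotone tree, and this becomes a linear
  recurrence in \<open>k\<close> and \<open>l\<close> for generating functions. All of them are solved with
  \<open>C = 1 + x C\<^sup>2\<close>. The monotone permutations of length between \<open>max k l\<close> and \<open>k + l - 2\<close>, whose
  prescribed beginning and end overlap, account for the rational summand in the first and third
  formula. For the fourth one, the coefficient at \<open>y\<^sup>k z\<^sup>l\<close> minus \<open>x\<close> times its two predecessors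
  is \<open>(C - 1) (x C)\<^bsup>k+l\<^esup>\<close>, apart from three initial terms (\<open>perm_gf_xyz_nth_rec\<close>); multiplying out
  the denominator \<open>1 - x (y + z)\<close> says exactly this.
\<close>

section \<open>Binary trees and words\<close>

datatype btree = Leaf | Node btree btree

text \<open>
  The avoiding permutation of \<open>{c + 1..c + size t}\<close> coded by \<open>t\<close>. Since the lower part \<open>v\<close> takes the
  values directly above \<open>c\<close>, the size of \<open>v\<close> fixes the first letter.
\<close>

fun word :: "nat \<Rightarrow> btree \<Rightarrow> nat list" where
  "word c Leaf = []"
| "word c (Node u v) = (c + size v + 1) # word (c + size v + 1) u @ word c v"

lemma length_word [simp]: "length (word c t) = size t"
  by (induction t arbitrary: c) auto

lemma word_eq_Nil_iff [simp]: "word c t = [] \<longleftrightarrow> t = Leaf"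
  by (cases t) auto

lemma size_btree_eq_0_iff [simp]: "size (t :: btree) = 0 \<longleftrightarrow> t = Leaf"
  by (cases t) auto

lemma set_word: "set (word c t) = {c + 1..c + size t}"
  by (induction t arbitrary: c) auto

lemma distinct_word: "distinct (word c t)"
  by (induction t arbitrary: c) (auto simp: set_word)

lemma word_shift: "word (d + c) t = map (\<lambda>i. i + d) (word c t)"
proof (induction t arbitrary: c)
  case (Node u v)
  show ?case using Node.IH(1)[of "c + size v + 1"] Node.IH(2)[of c] by (simp add: add.assoc)
qed simp

text \<open>
  The first letter of the word reveals the size of the lower subtree, hence where the word splits.
\<close>

lemma word_inject: "word c t = word c t' \<Longrightarrow> t = t'"
proof (induction t arbitrary: c t')
  case Leaf
  then show ?case by (metis word.simps(1) word_eq_Nil_iff)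
next
  case (Node u v)
  then obtain u' v' where t': "t' = Node u' v'" by (cases t') auto
  from Node.prems have v: "size v = size v'" by (simp add: t')
  with Node.prems have "word (c + size v + 1) u = word (c + size v + 1) u'" "word c v = word c v'"
    by (simp_all add: t')
  with Node.IH show ?case by (auto simp: t')
qed

text \<open>
  Avoidance of \<open>2-13\<close> organised by the letter that plays the role of \<open>2\<close>, so that it can be
  followed along the tree recursion.
\<close>

fun word_avoids :: "nat list \<Rightarrow> bool" where
  "word_avoids [] \<longleftrightarrow> True"
| "word_avoids (a # xs) \<longleftrightarrow> successively (\<lambda>x y. \<not> (x < a \<and> a < y)) xs \<and> word_avoids xs"

lemma successivelyI:
  "(\<And>x y. x \<in> set xs \<Longrightarrow> y \<in> set xs \<Longrightarrow> P x y) \<Longrightarrow> successively P xs"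
  by (simp add: successively_conv_nth)

lemma word_avoids_iff_nth:
  "word_avoids xs \<longleftrightarrow>
     (\<forall>i j. i < j \<longrightarrow> Suc j < length xs \<longrightarrow> \<not> (xs ! j < xs ! i \<and> xs ! i < xs ! Suc j))"
  (is "_ \<longleftrightarrow> (\<forall>i j. ?ok xs i j)")
proof (induction xs)
  case (Cons a xs)
  have ok_0: "?ok (a # xs) i 0" for i by simp
  have ok_0_Suc: "?ok (a # xs) 0 (Suc j) \<longleftrightarrow>
      (Suc j < length xs \<longrightarrow> \<not> (xs ! j < a \<and> a < xs ! Suc j))" for j
    by simp
  have ok_Suc_Suc: "?ok (a # xs) (Suc i) (Suc j) \<longleftrightarrow> ?ok xs i j" for i j
    by simp
  have "(\<forall>i j. Q i j) \<longleftrightarrow> (\<forall>j. Q 0 (Suc j)) \<and> (\<forall>i j. Q (Suc i) (Suc j))"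
    if "\<And>i. Q i 0" for Q :: "nat \<Rightarrow> nat \<Rightarrow> bool"
    using that by (metis not0_implies_Suc)
  from this[of "?ok (a # xs)", OF ok_0] show ?case
    unfolding ok_0_Suc ok_Suc_Suc using Cons.IH by (simp add: successively_conv_nth)
qed simp

text \<open>
  A letter of \<open>xs\<close> cannot be the \<open>2\<close> of a pattern reaching into \<open>ys\<close>: the letter \<open>3\<close> would lie in
  \<open>ys\<close> and be too small.
\<close>

lemma word_avoids_append:
  assumes "\<And>x y. x \<in> set xs \<Longrightarrow> y \<in> set ys \<Longrightarrow> y < x"
  shows "word_avoids (xs @ ys) \<longleftrightarrow> word_avoids xs \<and> word_avoids ys"
  using assms
proof (induction xs)
  case (Cons b xs)
  have "successively (\<lambda>x y. \<not> (x < b \<and> b < y)) ys"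
    using Cons.prems by (intro successivelyI) (auto dest: less_imp_not_less)
  moreover have "xs = [] \<or> ys = [] \<or> \<not> (last xs < b \<and> b < hd ys)"
    using Cons.prems by (cases ys) (auto dest: less_imp_not_less)
  ultimately show ?case
    using Cons by (auto simp: successively_append_iff)
qed simp

text \<open>
  The decomposition \<open>a U V\<close>: once the letters after \<open>a\<close> have dropped below \<open>a\<close>, they cannot
  return above it.
\<close>

lemma word_avoids_split:
  fixes a :: nat
  assumes "successively (\<lambda>x y. \<not> (x < a \<and> a < y)) ys" "a \<notin> set ys"
  obtains us vs where "ys = us @ vs" "\<forall>x\<in>set us. a < x" "\<forall>y\<in>set vs. y < a"
  using assms
proof (induction ys arbitrary: thesis)
  case (Cons y ys)
  have "successively (\<lambda>x y. \<not> (x < a \<and> a < y)) ys" "a \<notin> set ys"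
    using Cons.prems(2,3) by (auto simp: successively_Cons)
  then obtain us vs
    where *: "ys = us @ vs" "\<forall>x\<in>set us. a < x" "\<forall>y\<in>set vs. y < a"
    using Cons.IH by blast
  show ?case
  proof (cases "a < y")
    case True
    with * show ?thesis by (intro Cons.prems(1)[of "y # us" vs]) auto
  next
    case False
    with Cons.prems have "y < a" by auto
    moreover from this * Cons.prems have "us = []" by (cases us) auto
    ultimately show ?thesis using * by (intro Cons.prems(1)[of "[]" "y # vs"]) auto
  qed
qed simp

lemma word_avoids_word: "word_avoids (word c t)"
proof (induction t arbitrary: c)
  case (Node u v)
  let ?a = "c + size v + 1"
  have "successively (\<lambda>x y. \<not> (x < ?a \<and> ?a < y)) (word ?a u)"
    by (intro successivelyI) (auto simp: set_word)
  moreover have "successively (\<lambda>x y. \<not> (x < ?a \<and> ?a < y)) (word c v)"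
    by (intro successivelyI) (auto simp: set_word)
  moreover have "v = Leaf \<or> hd (word c v) \<in> set (word c v)"
    by (cases v) auto
  ultimately have "successively (\<lambda>x y. \<not> (x < ?a \<and> ?a < y)) (word ?a u @ word c v)"
    by (auto simp: successively_append_iff set_word)
  moreover have "word_avoids (word ?a u @ word c v)"
    using Node by (subst word_avoids_append) (auto simp: set_word)
  ultimately show ?case by simp
qed simp

text \<open>
  After splitting \<open>xs = a us vs\<close>, the two parts must take all values above and all values below \<open>a\<close>,
  so that both are again words on intervals.
\<close>

lemma word_surj:
  assumes "word_avoids xs" "distinct xs" "set xs = {c + 1..c + length xs}"
  shows "\<exists>t. word c t = xs"
  using assms
proof (induction xs arbitrary: c rule: length_induct)
  case (1 xs)
  show ?case
  proof (cases xs)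
    case Nil
    then show ?thesis by (intro exI[of _ Leaf]) simp
  next
    case (Cons a ys)
    obtain us vs where split: "ys = us @ vs" "\<forall>x\<in>set us. a < x" "\<forall>y\<in>set vs. y < a"
      using word_avoids_split[of a ys] 1(2,3) Cons by auto
    have sets: "insert a (set us \<union> set vs) = {c + 1..c + length xs}"
      using 1(4) Cons split(1) by simp
    have a: "c + 1 \<le> a" "a \<le> c + length xs" using sets by auto
    have vs: "set vs = {c + 1..a - 1}"
    proof (intro equalityI subsetI)
      fix i assume i: "i \<in> {c + 1..a - 1}"
      then have "i \<in> insert a (set us \<union> set vs)" unfolding sets using a by auto
      with i split show "i \<in> set vs" by fastforce
    next
      fix i assume i: "i \<in> set vs"
      with split have "i < a" by auto
      moreover have "i \<in> {c + 1..c + length xs}" using i sets by auto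
      ultimately show "i \<in> {c + 1..a - 1}" by auto
    qed
    have us: "set us = {a + 1..c + length xs}"
    proof (intro equalityI subsetI)
      fix i assume i: "i \<in> {a + 1..c + length xs}"
      then have "i \<in> insert a (set us \<union> set vs)" unfolding sets using a by auto
      with i split show "i \<in> set us" by fastforce
    next
      fix i assume i: "i \<in> set us"
      with split have "a < i" by auto
      moreover have "i \<in> {c + 1..c + length xs}" using i sets by auto
      ultimately show "i \<in> {a + 1..c + length xs}" by auto
    qed
    have d: "distinct us" "distinct vs" using 1(3) Cons split(1) by auto
    have lvs: "length vs = a - 1 - c"
      using distinct_card[OF d(2)] vs by simp
    have lus: "length us = c + length xs - a"
      using distinct_card[OF d(1)] us by simp
    have "word_avoids (us @ vs)" using 1(2) Cons split(1) by simp
    then have "word_avoids us" "word_avoids vs"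
      using split(2,3) by (subst (asm) word_avoids_append; fastforce)+
    moreover have "set us = {a + 1..a + length us}" using us lus a by simp
    moreover have "set vs = {c + 1..c + length vs}" using vs lvs a by simp
    moreover have "length us < length xs" "length vs < length xs"
      using Cons split(1) by auto
    ultimately obtain u v where "word a u = us" "word c v = vs"
      using 1(1) d by meson
    moreover from this have "c + size v + 1 = a" using lvs a length_word[of c v] by simp
    ultimately show ?thesis
      using Cons split(1) by (intro exI[of _ "Node u v"]) auto
  qed
qed

section \<open>Monotone beginnings and ends\<close>

definition prefix_run :: "(nat \<Rightarrow> nat \<Rightarrow> bool) \<Rightarrow> nat \<Rightarrow> nat list \<Rightarrow> bool" where
  "prefix_run R k xs \<longleftrightarrow> k \<le> length xs \<and> sorted_wrt R (take k xs)"

definition suffix_run :: "(nat \<Rightarrow> nat \<Rightarrow> bool) \<Rightarrow> nat \<Rightarrow> nat list \<Rightarrow> bool" where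
  "suffix_run R l xs \<longleftrightarrow> l \<le> length xs \<and> sorted_wrt R (drop (length xs - l) xs)"

lemma sorted_wrt_map_upt: "sorted_wrt R (map p [a..<b]) \<longleftrightarrow> monotone_on {a..<b} (<) R p"
proof
  assume *: "sorted_wrt R (map p [a..<b])"
  show "monotone_on {a..<b} (<) R p"
  proof (rule monotone_onI)
    fix x y assume "x \<in> {a..<b}" "y \<in> {a..<b}" "x < y"
    then show "R (p x) (p y)"
      using sorted_wrt_nth_less[OF *, of "x - a" "y - a"] by auto
  qed
next
  assume "monotone_on {a..<b} (<) R p"
  then show "sorted_wrt R (map p [a..<b])"
    by (auto simp: sorted_wrt_iff_nth_less monotone_on_def)
qed

lemma prefix_run_map_upt:
  "prefix_run R k (map p [1..<Suc n]) \<longleftrightarrow> k \<le> n \<and> monotone_on {1..k} (<) R p"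
  by (auto simp: prefix_run_def take_map atLeastLessThanSuc_atLeastAtMost sorted_wrt_map_upt
      simp del: upt_Suc)

lemma suffix_run_map_upt:
  "suffix_run R l (map p [1..<Suc n]) \<longleftrightarrow> l \<le> n \<and> monotone_on {n - l + 1..n} (<) R p"
  by (auto simp: suffix_run_def drop_map atLeastLessThanSuc_atLeastAtMost sorted_wrt_map_upt
      simp del: upt_Suc)

text \<open>
  For the relations \<open><\<close> and \<open>>\<close>, runs do not depend on the offset of the values. The offset is
  written as a successor to keep the equations usable as terminating rewrite rules.
\<close>

lemma runs_word_Suc:
  assumes "\<And>x y. R (x + Suc c) (y + Suc c) \<longleftrightarrow> R x y"
  shows "prefix_run R k (word (Suc c) t) \<longleftrightarrow> prefix_run R k (word 0 t)"
    and "suffix_run R l (word (Suc c) t) \<longleftrightarrow> suffix_run R l (word 0 t)"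
  unfolding word_shift[of "Suc c" 0 t, unfolded add_0_right] using assms
  by (simp_all add: prefix_run_def suffix_run_def take_map drop_map sorted_wrt_map)

definition asc_start :: "nat \<Rightarrow> btree set" where
  "asc_start k = {t. prefix_run (<) k (word 0 t)}"

definition desc_start :: "nat \<Rightarrow> btree set" where
  "desc_start k = {t. prefix_run (>) k (word 0 t)}"

definition asc_end :: "nat \<Rightarrow> btree set" where
  "asc_end l = {t. suffix_run (<) l (word 0 t)}"

definition desc_end :: "nat \<Rightarrow> btree set" where
  "desc_end l = {t. suffix_run (>) l (word 0 t)}"

lemma start_end_0 [simp]:
  "asc_start 0 = UNIV" "desc_start 0 = UNIV" "asc_end 0 = UNIV" "desc_end 0 = UNIV"
  by (auto simp: asc_start_def desc_start_def asc_end_def desc_end_def prefix_run_def suffix_run_def)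

lemma start_end_1:
  "asc_start (Suc 0) = - {Leaf}" "desc_start (Suc 0) = - {Leaf}"
  "asc_end (Suc 0) = - {Leaf}" "desc_end (Suc 0) = - {Leaf}"
proof -
  have *: "sorted_wrt R (take (Suc 0) xs)" "sorted_wrt R (drop (length xs - Suc 0) xs)"
    for R :: "nat \<Rightarrow> nat \<Rightarrow> bool" and xs
    by (rule sorted_wrt01, simp)+
  have **: "Suc 0 \<le> size t \<longleftrightarrow> t \<noteq> Leaf" for t :: btree
    by (cases t) auto
  show "asc_start (Suc 0) = - {Leaf}" "desc_start (Suc 0) = - {Leaf}"
    "asc_end (Suc 0) = - {Leaf}" "desc_end (Suc 0) = - {Leaf}"
    using *(1) *(2)[of _ "word _ _", simplified]
    by (auto simp: asc_start_def desc_start_def asc_end_def desc_end_def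
        prefix_run_def suffix_run_def ** simp del: One_nat_def)
qed

lemma Leaf_start_end [simp]:
  "Leaf \<in> asc_start k \<longleftrightarrow> k = 0" "Leaf \<in> desc_start k \<longleftrightarrow> k = 0"
  "Leaf \<in> asc_end k \<longleftrightarrow> k = 0" "Leaf \<in> desc_end k \<longleftrightarrow> k = 0"
  by (auto simp: asc_start_def desc_start_def asc_end_def desc_end_def prefix_run_def suffix_run_def)

text \<open>
  The trees of the increasing and of the decreasing permutation of a given length.
\<close>

fun left_comb :: "nat \<Rightarrow> btree" where
  "left_comb 0 = Leaf"
| "left_comb (Suc n) = Node (left_comb n) Leaf"

fun right_comb :: "nat \<Rightarrow> btree" where
  "right_comb 0 = Leaf"
| "right_comb (Suc n) = Node Leaf (right_comb n)"

lemma size_comb [simp]: "size (left_comb n) = n" "size (right_comb n) = n"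
  by (induction n) auto

lemma word_ascending_iff: "sorted_wrt (<) (word c t) \<longleftrightarrow> t = left_comb (size t)"
proof (induction t arbitrary: c)
  case (Node u v)
  have "sorted_wrt (<) (word c (Node u v)) \<longleftrightarrow>
      v = Leaf \<and> sorted_wrt (<) (word (c + size v + 1) u)"
    by (cases v) (auto simp: set_word)
  with Node.IH(1)[of "c + size v + 1"] show ?case by auto
qed simp

lemma word_descending_iff: "sorted_wrt (>) (word c t) \<longleftrightarrow> t = right_comb (size t)"
proof (induction t arbitrary: c)
  case (Node u v)
  have "sorted_wrt (>) (word c (Node u v)) \<longleftrightarrow> u = Leaf \<and> sorted_wrt (>) (word c v)"
    by (cases u) (auto simp: set_word)
  with Node.IH(2)[of c] show ?case by auto
qed simp

lemma comb_start_end [simp]: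
  "left_comb n \<in> asc_start k \<longleftrightarrow> k \<le> n" "left_comb n \<in> asc_end k \<longleftrightarrow> k \<le> n"
  "right_comb n \<in> desc_start k \<longleftrightarrow> k \<le> n" "right_comb n \<in> desc_end k \<longleftrightarrow> k \<le> n"
  using word_ascending_iff[of 0 "left_comb n"] word_descending_iff[of 0 "right_comb n"]
  by (auto simp: asc_start_def desc_start_def asc_end_def desc_end_def prefix_run_def suffix_run_def
      intro: sorted_wrt_take sorted_wrt_drop)

text \<open>
  The first letter of \<open>v\<close> lies below the root letter, so an increasing prefix cannot reach into \<open>v\<close>.
\<close>

lemma Node_in_asc_start: "Node u v \<in> asc_start (Suc k) \<longleftrightarrow> u \<in> asc_start k"
proof -
  let ?a = "Suc (size v)"
  have "Node u v \<in> asc_start (Suc k) \<longleftrightarrow>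
      k \<le> size u + size v \<and> (\<forall>x\<in>set (take k (word ?a u @ word 0 v)). ?a < x) \<and>
      sorted_wrt (<) (take k (word ?a u @ word 0 v))"
    by (auto simp: asc_start_def prefix_run_def)
  also have "\<dots> \<longleftrightarrow> k \<le> size u \<and> sorted_wrt (<) (take k (word ?a u))"
  proof (cases "k \<le> size u")
    case True
    then show ?thesis using set_take_subset[of k "word ?a u"] by (auto simp: set_word)
  next
    case False
    have "\<exists>x\<in>set (take k (word ?a u @ word 0 v)). \<not> ?a < x" if "k \<le> size u + size v"
    proof -
      have "v \<noteq> Leaf" using that False by auto
      then obtain y ys where y: "word 0 v = y # ys" by (cases "word 0 v") auto
      then have "y \<in> set (take k (word ?a u @ word 0 v))"
        using False by (simp add: take_Cons')
      moreover have "y \<in> set (word 0 v)" by (simp add: y)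
      then have "y \<le> size v" by (simp add: set_word)
      ultimately show ?thesis by (intro bexI[of _ y]) auto
    qed
    with False show ?thesis by blast
  qed
  also have "\<dots> \<longleftrightarrow> prefix_run (<) k (word ?a u)"
    by (simp add: prefix_run_def)
  finally show ?thesis by (simp add: asc_start_def runs_word_Suc)
qed

text \<open>
  If \<open>u\<close> is nonempty, then the word starts with an ascent.
\<close>

lemma Node_in_desc_start:
  "Node u v \<in> desc_start (Suc (Suc k)) \<longleftrightarrow> u = Leaf \<and> v \<in> desc_start (Suc k)"
proof (cases u)
  case Leaf
  have "(\<forall>x\<in>set (take (Suc k) (word 0 v)). x < Suc (size v))"
    using set_take_subset[of "Suc k" "word 0 v"] by (auto simp: set_word)
  with Leaf show ?thesis by (auto simp: desc_start_def prefix_run_def)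
next
  case (Node u1 u2)
  then show ?thesis by (auto simp: desc_start_def prefix_run_def)
qed

lemma suffix_run_append_le:
  "l \<le> length ys \<Longrightarrow> suffix_run R l (xs @ ys) \<longleftrightarrow> suffix_run R l ys"
  by (simp add: suffix_run_def)

lemma suffix_run_append_gt:
  "length ys \<le> l \<Longrightarrow> suffix_run R l (xs @ ys) \<longleftrightarrow>
     sorted_wrt R ys \<and> suffix_run R (l - length ys) xs \<and>
     (\<forall>x\<in>set (drop (length xs + length ys - l) xs). \<forall>y\<in>set ys. R x y)"
  by (auto simp: suffix_run_def sorted_wrt_append)

text \<open>
  If \<open>v\<close> is nonempty, an increasing suffix lies inside \<open>v\<close>, as the letter before \<open>v\<close> exceeds all
  of \<open>v\<close>. If \<open>v\<close> is empty, the suffix may also be the whole word, which is then increasing.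
\<close>

lemma Node_in_asc_end:
  "Node u v \<in> asc_end (Suc l) \<longleftrightarrow>
     v \<in> asc_end (Suc l) \<or> v = Leaf \<and> (u \<in> asc_end (Suc l) \<or> u = left_comb l)"
proof (cases v)
  case Leaf
  have w: "word 0 (Node u v) = [1] @ word 1 u" using Leaf by simp
  show ?thesis
  proof (cases "Suc l \<le> size u")
    case True
    then have "u \<noteq> left_comb l" by auto
    moreover have "\<not> suffix_run (<) (Suc l) []" by (simp add: suffix_run_def)
    ultimately show ?thesis using True Leaf
      using suffix_run_append_le[of "Suc l" "word 1 u" "(<)" "[1]"]
      by (simp add: asc_end_def runs_word_Suc)
  next
    case False
    then have "suffix_run (<) (Suc l) ([1] @ word 1 u) \<longleftrightarrow>
        size u = l \<and> u = left_comb (size u)"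
      by (auto simp: suffix_run_def set_word simp flip: word_ascending_iff[of 1])
    then have "suffix_run (<) (Suc l) ([1] @ word 1 u) \<longleftrightarrow> u = left_comb l"
      by (metis size_comb(1))
    with False Leaf show ?thesis
      by (auto simp: asc_end_def suffix_run_def)
  qed
next
  case (Node v1 v2)
  let ?xs = "(size v + 1) # word (size v + 1) u"
  have w: "word 0 (Node u v) = ?xs @ word 0 v" by simp
  show ?thesis
  proof (cases "Suc l \<le> size v")
    case True
    then show ?thesis using Node suffix_run_append_le[of "Suc l" "word 0 v" "(<)" ?xs]
      unfolding asc_end_def mem_Collect_eq w by simp
  next
    case False
    let ?ds = "drop (length ?xs + size v - Suc l) ?xs"
    have "\<not> suffix_run (<) (Suc l) (?xs @ word 0 v)"
    proof
      assume *: "suffix_run (<) (Suc l) (?xs @ word 0 v)"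
      then have "?ds \<noteq> []" using False by (auto simp: suffix_run_def)
      then obtain x where x: "x \<in> set ?ds" by (meson last_in_set)
      then have "x \<in> set ?xs" by (rule in_set_dropD)
      then have "size v < x" by (auto simp: set_word)
      moreover have "1 \<in> set (word 0 v)" using Node by (simp add: set_word del: word.simps)
      then have "x < 1"
        using * x suffix_run_append_gt[of "word 0 v" "Suc l" "(<)" ?xs] False by auto
      ultimately show False by simp
    qed
    then show ?thesis using Node False unfolding asc_end_def mem_Collect_eq w
      by (auto simp: suffix_run_def)
  qed
qed

lemma suffix_run_desc_Cons:
  assumes "\<And>x. x \<in> set xs \<Longrightarrow> a < x"
  shows "suffix_run (>) (Suc l) (a # xs) \<longleftrightarrow> suffix_run (>) (Suc l) xs \<or> xs = [] \<and> l = 0"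
proof (cases "Suc l \<le> length xs")
  case True
  then show ?thesis using suffix_run_append_le[of "Suc l" xs "(>)" "[a]"] by auto
next
  case False
  then show ?thesis using assms by (cases xs) (force simp: suffix_run_def)+
qed

text \<open>
  A decreasing suffix may extend to the left of \<open>v\<close>. Then \<open>v\<close> is the decreasing permutation of some
  length \<open>s\<close>, and what remains ends \<open>u\<close>, or it is the root letter alone with \<open>u\<close> empty.
\<close>

lemma Node_in_desc_end:
  "Node u v \<in> desc_end (Suc l) \<longleftrightarrow>
     v \<in> desc_end (Suc l) \<or>
     (\<exists>s\<le>l. v = right_comb s \<and> (u \<in> desc_end (Suc l - s) \<or> u = Leaf \<and> s = l))"
proof -
  let ?xs = "(size v + 1) # word (size v + 1) u"
  have w: "word 0 (Node u v) = ?xs @ word 0 v" by simp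
  show ?thesis
  proof (cases "Suc l \<le> size v")
    case True
    then have "Node u v \<in> desc_end (Suc l) \<longleftrightarrow> v \<in> desc_end (Suc l)"
      using suffix_run_append_le[of "Suc l" "word 0 v" "(>)" ?xs]
      unfolding desc_end_def mem_Collect_eq w by simp
    moreover have "v \<noteq> right_comb s" if "s \<le> l" for s
      using True that by auto
    ultimately show ?thesis by blast
  next
    case False
    have gt: "\<forall>x\<in>set (drop i ?xs). \<forall>y\<in>set (word 0 v). y < x" for i
      by (auto simp: set_word dest!: in_set_dropD simp del: drop_Cons')
    have "Node u v \<in> desc_end (Suc l) \<longleftrightarrow>
        v = right_comb (size v) \<and> suffix_run (>) (Suc (l - size v)) ?xs"
      using suffix_run_append_gt[of "word 0 v" "Suc l" "(>)" ?xs] False gt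
      unfolding desc_end_def mem_Collect_eq w word_descending_iff[symmetric, of _ 0]
      by (simp add: Suc_diff_le)
    also have "suffix_run (>) (Suc (l - size v)) ?xs \<longleftrightarrow>
        suffix_run (>) (Suc (l - size v)) (word (size v + 1) u) \<or> u = Leaf \<and> l - size v = 0"
      by (subst suffix_run_desc_Cons) (auto simp: set_word)
    also have "suffix_run (>) (Suc (l - size v)) (word (size v + 1) u) \<longleftrightarrow>
        u \<in> desc_end (Suc l - size v)"
      using False by (simp add: desc_end_def runs_word_Suc Suc_diff_le)
    finally have "Node u v \<in> desc_end (Suc l) \<longleftrightarrow>
        v = right_comb (size v) \<and> (u \<in> desc_end (Suc l - size v) \<or> u = Leaf \<and> size v = l)"
      using False by auto
    moreover have "v \<notin> desc_end (Suc l)"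
      using False by (simp add: desc_end_def suffix_run_def)
    moreover have "(\<exists>s\<le>l. v = right_comb s \<and> P s) \<longleftrightarrow> v = right_comb (size v) \<and> P (size v)" for P
      using False by (metis size_comb(2) not_less_eq_eq)
    ultimately show ?thesis by simp
  qed
qed

section \<open>Generating functions of sets of trees\<close>

definition tree_gf :: "btree set \<Rightarrow> rat fps" where
  "tree_gf A = Abs_fps (\<lambda>n. of_nat (card {t \<in> A. size t = n}))"

definition nodes :: "btree set \<Rightarrow> btree set \<Rightarrow> btree set" where
  "nodes A B = {Node u v |u v. u \<in> A \<and> v \<in> B}"

lemma Leaf_notin_nodes [simp]: "Leaf \<notin> nodes A B"
  and Node_in_nodes [simp]: "Node u v \<in> nodes A B \<longleftrightarrow> u \<in> A \<and> v \<in> B"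
  by (auto simp: nodes_def)

lemma btree_set_eqI:
  assumes "Leaf \<in> A \<longleftrightarrow> Leaf \<in> B" "\<And>u v. Node u v \<in> A \<longleftrightarrow> Node u v \<in> B"
  shows "A = B"
proof (rule set_eqI)
  fix t show "t \<in> A \<longleftrightarrow> t \<in> B" using assms by (cases t) auto
qed

lemma finite_btree_size_eq: "finite {t \<in> A. size (t :: btree) = n}"
proof -
  have "finite {t. size (t :: btree) \<le> n}"
  proof (induction n)
    case 0
    have "{t. size (t :: btree) \<le> 0} = {Leaf}" by auto
    then show ?case by simp
  next
    case (Suc n)
    let ?N = "{t. size (t :: btree) \<le> n}"
    have "{t. size (t :: btree) \<le> Suc n} \<subseteq> insert Leaf ((\<lambda>(u, v). Node u v) ` (?N \<times> ?N))"
    proof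
      fix t :: btree assume "t \<in> {t. size t \<le> Suc n}"
      then show "t \<in> insert Leaf ((\<lambda>(u, v). Node u v) ` (?N \<times> ?N))"
        by (cases t) auto
    qed
    then show ?case using Suc by (meson finite_SigmaI finite_imageI finite_insert finite_subset)
  qed
  then show ?thesis by (rule rev_finite_subset) auto
qed

lemma tree_gf_empty [simp]: "tree_gf {} = 0"
  by (rule fps_ext) (simp add: tree_gf_def)

lemma tree_gf_singleton [simp]: "tree_gf {t} = fps_X ^ size t"
proof (rule fps_ext)
  fix n
  have "{t' \<in> {t}. size t' = n} = (if size t = n then {t} else {})" by auto
  then show "tree_gf {t} $ n = fps_X ^ size t $ n" by (simp add: tree_gf_def)
qed

lemma tree_gf_Un: "A \<inter> B = {} \<Longrightarrow> tree_gf (A \<union> B) = tree_gf A + tree_gf B"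
proof (rule fps_ext)
  fix n assume "A \<inter> B = {}"
  moreover have "{t \<in> A \<union> B. size t = n} = {t \<in> A. size t = n} \<union> {t \<in> B. size t = n}" by auto
  ultimately have "card {t \<in> A \<union> B. size t = n} =
      card {t \<in> A. size t = n} + card {t \<in> B. size t = n}"
    by (auto intro!: card_Un_disjoint finite_btree_size_eq)
  then show "tree_gf (A \<union> B) $ n = (tree_gf A + tree_gf B) $ n" by (simp add: tree_gf_def)
qed

lemma tree_gf_UN:
  assumes "finite I" "\<And>i j. i \<in> I \<Longrightarrow> j \<in> I \<Longrightarrow> i \<noteq> j \<Longrightarrow> A i \<inter> A j = {}"
  shows "tree_gf (\<Union>i\<in>I. A i) = (\<Sum>i\<in>I. tree_gf (A i))"
  using assms
proof (induction I rule: finite_induct)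
  case (insert i I)
  then have "A i \<inter> (\<Union>i\<in>I. A i) = {}" by fastforce
  with insert show ?case by (simp add: tree_gf_Un)
qed simp

lemma tree_gf_nodes: "tree_gf (nodes A B) = fps_X * tree_gf A * tree_gf B"
proof (rule fps_ext)
  fix n
  show "tree_gf (nodes A B) $ n = (fps_X * tree_gf A * tree_gf B) $ n"
  proof (cases n)
    case 0
    have "{t \<in> nodes A B. size t = 0} = {}" by auto
    then show ?thesis using 0 by (simp add: tree_gf_def mult.assoc)
  next
    case (Suc m)
    let ?S = "\<lambda>A n. {t \<in> A. size (t :: btree) = n}"
    let ?N = "\<lambda>i. (\<lambda>(u, v). Node u v) ` (?S A i \<times> ?S B (m - i))"
    have "?S (nodes A B) n = (\<Union>i\<in>{0..m}. ?N i)"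
    proof (rule set_eqI)
      fix t show "t \<in> ?S (nodes A B) n \<longleftrightarrow> t \<in> (\<Union>i\<in>{0..m}. ?N i)"
        by (cases t) (auto simp: Suc image_iff)
    qed
    then have "card (?S (nodes A B) n) = (\<Sum>i=0..m. card (?N i))"
      by (simp only:) (rule card_UN_disjoint; auto intro: finite_btree_size_eq)
    also have "\<dots> = (\<Sum>i=0..m. card (?S A i) * card (?S B (m - i)))"
      by (intro sum.cong refl, subst card_image) (auto simp: inj_on_def card_cartesian_product)
    finally have "tree_gf (nodes A B) $ n = (tree_gf A * tree_gf B) $ m"
      by (simp add: tree_gf_def fps_mult_nth)
    then show ?thesis by (simp add: Suc mult.assoc)
  qed
qed

text \<open>
  The quadratic equation that comes from the closed form by cancelling \<open>4 x\<close>.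
\<close>

lemma catalan_gf_functional: "catalan_gf = 1 + fps_X * catalan_gf ^ 2"
proof -
  have "4 * fps_X * (catalan_gf - (1 + fps_X * catalan_gf ^ 2)) = 0"
    using catalan_gf_closed_form by (simp add: power2_eq_square algebra_simps)
  then show ?thesis by simp
qed

text \<open>
  The series of all trees satisfies the same quadratic equation, and this equation has only one
  power series solution: the other factor of the difference has constant term \<open>1\<close>.
\<close>

lemma tree_gf_UNIV: "tree_gf UNIV = catalan_gf"
proof -
  let ?c = "tree_gf UNIV" and ?C = catalan_gf
  have "UNIV = {Leaf} \<union> nodes UNIV UNIV" by (rule btree_set_eqI) auto
  then have "?c = tree_gf ({Leaf} \<union> nodes UNIV UNIV)" by simp
  also have "\<dots> = 1 + fps_X * ?c ^ 2"
    by (subst tree_gf_Un) (auto simp: tree_gf_nodes power2_eq_square mult.assoc)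
  finally have c: "?c = 1 + fps_X * ?c ^ 2" .
  have "(?c - ?C) * (1 - fps_X * (?c + ?C)) =
      (?c - (1 + fps_X * ?c ^ 2)) - (?C - (1 + fps_X * ?C ^ 2))"
    by (simp add: power2_eq_square algebra_simps)
  also have "\<dots> = 0" using c catalan_gf_functional by simp
  finally have *: "(?c - ?C) * (1 - fps_X * (?c + ?C)) = 0" .
  have "(1 - fps_X * (?c + ?C)) $ 0 = 1" by simp
  then have "1 - fps_X * (?c + ?C) \<noteq> 0" by (metis fps_zero_nth zero_neq_one)
  with * show ?thesis by simp
qed

lemma tree_gf_nonempty: "tree_gf (- {Leaf}) = catalan_gf - 1"
proof -
  have "tree_gf (- {Leaf} \<union> {Leaf}) = tree_gf (- {Leaf}) + tree_gf {Leaf}"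
    by (rule tree_gf_Un) simp
  moreover have "- {Leaf} \<union> {Leaf} = UNIV" by auto
  ultimately show ?thesis by (simp add: tree_gf_UNIV eq_diff_eq)
qed

section \<open>Recurrences and their solutions\<close>

text \<open>
  Only the upper subtree is constrained, so each further ascending letter costs a factor
  \<open>x C\<close>.
\<close>

lemma tree_gf_asc_start: "tree_gf (asc_start k) = fps_X ^ k * catalan_gf ^ (k + 1)"
proof (induction k)
  case 0
  then show ?case by (simp add: tree_gf_UNIV)
next
  case (Suc k)
  have "asc_start (Suc k) = nodes (asc_start k) UNIV"
    by (rule btree_set_eqI) (auto simp: Node_in_asc_start)
  with Suc show ?case by (simp add: tree_gf_nodes tree_gf_UNIV mult_ac)
qed

lemma catalan_gf_sq_inverse: "catalan_gf ^ 2 * (1 - fps_X * catalan_gf - fps_X) = 1"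
  using catalan_gf_functional by algebra

text \<open>
  Both recurrences for the final runs have this shape: the first term stands for a suffix inside
  \<open>v\<close> with \<open>u\<close> arbitrary, the second for a suffix inside \<open>u\<close> with \<open>v\<close> empty.
\<close>

lemma catalan_gf_solve:
  assumes "F = fps_X * catalan_gf * F + fps_X * F + G"
  shows "F = catalan_gf ^ 2 * G"
proof -
  have "G = (1 - fps_X * catalan_gf - fps_X) * F" using assms by algebra
  then show ?thesis using catalan_gf_sq_inverse by algebra
qed

text \<open>
  The three terms: \<open>v\<close> carries the suffix; \<open>v\<close> is empty and \<open>u\<close> carries prefix and suffix;
  the increasing permutation of length \<open>l + 1\<close>, where the suffix is the whole word.
\<close>

lemma tree_gf_asc_asc_step:
  "tree_gf (asc_start (Suc k) \<inter> asc_end (Suc l)) =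
     fps_X * tree_gf (asc_start k) * tree_gf (asc_end (Suc l)) +
     fps_X * tree_gf (asc_start k \<inter> asc_end (Suc l)) +
     (if k \<le> l then fps_X ^ Suc l else 0)"
proof -
  let ?L = "if k \<le> l then {left_comb (Suc l)} else {}"
  have "asc_start (Suc k) \<inter> asc_end (Suc l) =
      nodes (asc_start k) (asc_end (Suc l)) \<union>
      (nodes (asc_start k \<inter> asc_end (Suc l)) {Leaf} \<union> ?L)"
    by (rule btree_set_eqI) (auto simp: Node_in_asc_start Node_in_asc_end)
  also have "tree_gf \<dots> = tree_gf (nodes (asc_start k) (asc_end (Suc l))) +
      tree_gf (nodes (asc_start k \<inter> asc_end (Suc l)) {Leaf} \<union> ?L)"
    by (rule tree_gf_Un) (auto simp: nodes_def)
  also have "tree_gf (nodes (asc_start k \<inter> asc_end (Suc l)) {Leaf} \<union> ?L) =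
      tree_gf (nodes (asc_start k \<inter> asc_end (Suc l)) {Leaf}) + tree_gf ?L"
    by (rule tree_gf_Un) auto
  finally show ?thesis by (simp add: tree_gf_nodes add.assoc)
qed

text \<open>
  A run of length 1 only asks for a nonempty tree. Hence the case of a prefix of length 1 in the
  step lemmas is an equation for the suffix alone.
\<close>

lemma start_Suc_Int_end_Suc_0:
  "asc_start (Suc 0) \<inter> asc_end (Suc l) = asc_end (Suc l)"
  "asc_start (Suc 0) \<inter> desc_end (Suc l) = desc_end (Suc l)"
  "desc_start (Suc 0) \<inter> asc_end (Suc l) = asc_end (Suc l)"
  "desc_start (Suc 0) \<inter> desc_end (Suc l) = desc_end (Suc l)"
  "asc_start (Suc k) \<inter> desc_end (Suc 0) = asc_start (Suc k)"
  by (auto simp: start_end_1)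

lemma tree_gf_asc_end: "tree_gf (asc_end (Suc l)) = fps_X ^ Suc l * catalan_gf ^ 2"
proof -
  have "tree_gf (asc_end (Suc l)) =
      fps_X * catalan_gf * tree_gf (asc_end (Suc l)) + fps_X * tree_gf (asc_end (Suc l)) +
      fps_X ^ Suc l"
    using tree_gf_asc_asc_step[of 0 l] by (simp add: start_Suc_Int_end_Suc_0 tree_gf_UNIV)
  from catalan_gf_solve[OF this] show ?thesis by (simp add: mult.commute)
qed

text \<open>
  The recurrence for the wholly monotone permutations in which the prescribed prefix, of length
  \<open>k + 1\<close>, and suffix, of length \<open>l + 1\<close>, share at least two letters. The claim is the geometric sum of \<open>x\<^sup>n\<close> for \<open>max (k + 1) (l + 1) \<le> n \<le> k + l\<close>.
\<close>

lemma overlap_recurrence: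
  fixes D :: "nat \<Rightarrow> rat fps"
  assumes "D 0 = 0" "\<And>k. D (Suc k) = fps_X * D k + (if Suc k \<le> l then fps_X ^ Suc l else 0)"
  shows "D k = (fps_X ^ max (Suc k) (Suc l) - fps_X ^ (k + l + 1)) / (1 - fps_X)"
proof -
  have "(1 - fps_X) * D k = fps_X ^ max (Suc k) (Suc l) - fps_X ^ (k + l + 1)"
  proof (induction k)
    case 0
    then show ?case by (simp add: assms(1))
  next
    case (Suc k)
    have "(1 - fps_X) * D (Suc k) = fps_X * ((1 - fps_X) * D k) +
        (1 - fps_X) * (if Suc k \<le> l then fps_X ^ Suc l else 0)"
      by (simp only: assms(2)) (simp add: algebra_simps)
    also have "\<dots> = fps_X ^ max (Suc (Suc k)) (Suc l) - fps_X ^ (Suc k + l + 1)"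
      unfolding Suc by (cases "Suc k \<le> l") (auto simp: max_def algebra_simps not_le)
    finally show ?case .
  qed
  moreover have "(1 - fps_X :: rat fps) \<noteq> 0"
    by (metis fps_X_neq_one right_minus_eq)
  ultimately show ?thesis by (metis nonzero_mult_div_cancel_left)
qed

lemma tree_gf_asc_asc:
  "tree_gf (asc_start (Suc k) \<inter> asc_end (Suc l)) =
     fps_X ^ (k + l + 1) * catalan_gf ^ (k + 2) +
     (fps_X ^ max (Suc k) (Suc l) - fps_X ^ (k + l + 1)) / (1 - fps_X)"
proof -
  \<comment> \<open>the contribution of the overlapping runs, which obeys the overlap recurrence\<close>
  define D where "D k = tree_gf (asc_start (Suc k) \<inter> asc_end (Suc l)) -
      fps_X ^ (k + l + 1) * catalan_gf ^ (k + 2)" for k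
  have "D k = (fps_X ^ max (Suc k) (Suc l) - fps_X ^ (k + l + 1)) / (1 - fps_X)"
  proof (rule overlap_recurrence)
    show "D 0 = 0"
      by (simp add: D_def start_Suc_Int_end_Suc_0 tree_gf_asc_end power2_eq_square)
    fix k
    \<comment> \<open>splitting off the variable powers leaves a polynomial identity modulo \<open>C = 1 + x C\<^sup>2\<close>\<close>
    define p where "p = fps_X ^ k * fps_X ^ l * catalan_gf ^ k"
    have p: "fps_X ^ (Suc k + l + 1) * catalan_gf ^ (Suc k + 2) = p * fps_X ^ 2 * catalan_gf ^ 3"
      "fps_X ^ (k + l + 1) * catalan_gf ^ (k + 2) = p * fps_X * catalan_gf ^ 2"
      "fps_X * (fps_X ^ Suc k * catalan_gf ^ (Suc k + 1)) * (fps_X ^ Suc l * catalan_gf ^ 2) =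
        p * fps_X ^ 3 * catalan_gf ^ 4"
      by (simp_all add: p_def power_add power2_eq_square power3_eq_cube power4_eq_xxxx mult_ac)
    show "D (Suc k) = fps_X * D k + (if Suc k \<le> l then fps_X ^ Suc l else 0)"
      unfolding D_def tree_gf_asc_asc_step[of "Suc k"] tree_gf_asc_start tree_gf_asc_end p
      using catalan_gf_functional by algebra
  qed
  then show ?thesis by (simp add: D_def algebra_simps)
qed

text \<open>
  Each further descending letter at the start is a root without upper subtree. The lower subtree is
  not empty, so it also carries the increasing suffix, and no exceptional case arises.
\<close>

lemma tree_gf_desc_asc:
  "tree_gf (desc_start (Suc k) \<inter> asc_end (Suc l)) = fps_X ^ (k + l + 1) * catalan_gf ^ 2"
proof (induction k)
  case 0
  then show ?case by (simp add: start_Suc_Int_end_Suc_0 tree_gf_asc_end)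
next
  case (Suc k)
  have "desc_start (Suc (Suc k)) \<inter> asc_end (Suc l) =
      nodes {Leaf} (desc_start (Suc k) \<inter> asc_end (Suc l))"
    by (rule btree_set_eqI) (auto simp: Node_in_desc_start Node_in_asc_end)
  with Suc show ?case by (simp add: tree_gf_nodes mult_ac)
qed

text \<open>
  The sum is over the length \<open>s\<close> of a wholly descending lower part that the suffix passes. The last
  term is the decreasing permutation of length \<open>l + 1\<close>, whose longest ascending prefix is a single
  letter, so that it counts only for \<open>k = 0\<close>.
\<close>

lemma tree_gf_asc_desc_step:
  "tree_gf (asc_start (Suc k) \<inter> desc_end (Suc l)) =
     fps_X * tree_gf (asc_start k) * tree_gf (desc_end (Suc l)) +
     (\<Sum>s\<le>l. fps_X * tree_gf (asc_start k \<inter> desc_end (Suc l - s)) * fps_X ^ s) +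
     (if k = 0 then fps_X ^ Suc l else 0)"
proof -
  let ?R = "if k = 0 then {right_comb (Suc l)} else {}"
  let ?N = "\<lambda>s. nodes (asc_start k \<inter> desc_end (Suc l - s)) {right_comb s}"
  have "asc_start (Suc k) \<inter> desc_end (Suc l) =
      nodes (asc_start k) (desc_end (Suc l)) \<union> ((\<Union>s\<le>l. ?N s) \<union> ?R)"
    by (rule btree_set_eqI) (auto simp: Node_in_asc_start Node_in_desc_end)
  also have "tree_gf \<dots> = tree_gf (nodes (asc_start k) (desc_end (Suc l))) +
      tree_gf ((\<Union>s\<le>l. ?N s) \<union> ?R)"
    by (rule tree_gf_Un) (auto simp: nodes_def)
  also have "tree_gf ((\<Union>s\<le>l. ?N s) \<union> ?R) = tree_gf (\<Union>s\<le>l. ?N s) + tree_gf ?R"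
    by (rule tree_gf_Un) (auto simp: nodes_def)
  also have "tree_gf (\<Union>s\<le>l. ?N s) = (\<Sum>s\<le>l. tree_gf (?N s))"
  proof (rule tree_gf_UN)
    fix i j :: nat assume "i \<noteq> j"
    then have "right_comb i \<noteq> right_comb j" by (metis size_comb(2))
    then show "?N i \<inter> ?N j = {}" by (auto simp: nodes_def)
  qed simp
  finally show ?thesis by (simp add: tree_gf_nodes add.assoc)
qed

text \<open>
  Lowering \<open>l\<close> by one and multiplying by \<open>x\<close> shifts the sum over \<open>s\<close>, so all but its first term
  cancel in the difference. The exceptional term cancels as well.
\<close>

lemma tree_gf_asc_desc_telescoped:
  "tree_gf (asc_start (Suc k) \<inter> desc_end (Suc (Suc l))) =
     fps_X * tree_gf (asc_start (Suc k) \<inter> desc_end (Suc l)) +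
     fps_X * tree_gf (asc_start k \<inter> desc_end (Suc (Suc l))) +
     fps_X * tree_gf (asc_start k) *
       (tree_gf (desc_end (Suc (Suc l))) - fps_X * tree_gf (desc_end (Suc l)))"
proof -
  let ?T = "\<lambda>l. \<Sum>s\<le>l. fps_X * tree_gf (asc_start k \<inter> desc_end (Suc l - s)) * fps_X ^ s"
  have "?T (Suc l) = fps_X * tree_gf (asc_start k \<inter> desc_end (Suc (Suc l))) + fps_X * ?T l"
    by (subst sum.atMost_Suc_shift) (simp add: sum_distrib_left mult_ac)
  then show ?thesis
    unfolding tree_gf_asc_desc_step[of k "Suc l"] tree_gf_asc_desc_step[of k l]
    by (simp add: algebra_simps)
qed

lemma tree_gf_desc_end: "tree_gf (desc_end l) = fps_X ^ l * catalan_gf ^ (l + 1)"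
proof (induction l)
  case 0
  then show ?case by (simp add: tree_gf_UNIV)
next
  case (Suc l)
  show ?case
  proof (cases l)
    case 0
    have "catalan_gf - 1 = fps_X * catalan_gf ^ 2" using catalan_gf_functional by algebra
    with 0 show ?thesis by (simp add: start_end_1 tree_gf_nonempty power2_eq_square)
  next
    case (Suc j)
    \<comment> \<open>the factor \<open>1 - x C\<close> is the inverse of \<open>C\<close>, so the step from \<open>l\<close> to \<open>l + 1\<close> is a factor \<open>x C\<close>\<close>
    let ?G = "(1 - fps_X * catalan_gf) * (fps_X * tree_gf (desc_end l))"
    have "tree_gf (desc_end (Suc l)) = fps_X * catalan_gf * tree_gf (desc_end (Suc l)) +
        fps_X * tree_gf (desc_end (Suc l)) + ?G"
      using tree_gf_asc_desc_telescoped[of 0 j]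
      by (simp add: Suc start_Suc_Int_end_Suc_0 tree_gf_UNIV algebra_simps)
    from catalan_gf_solve[OF this]
    have "tree_gf (desc_end (Suc l)) = catalan_gf * (fps_X * tree_gf (desc_end l))"
      using catalan_gf_functional by algebra
    then show ?thesis using Suc.IH by (simp add: mult_ac)
  qed
qed

lemma tree_gf_desc_desc:
  "tree_gf (desc_start (Suc k) \<inter> desc_end (Suc l)) =
     fps_X ^ (k + l + 1) * catalan_gf ^ (l + 2) +
     (fps_X ^ max (Suc k) (Suc l) - fps_X ^ (k + l + 1)) / (1 - fps_X)"
proof -
  define D where "D k = tree_gf (desc_start (Suc k) \<inter> desc_end (Suc l)) -
      fps_X ^ (k + l + 1) * catalan_gf ^ (l + 2)" for k
  have "D k = (fps_X ^ max (Suc k) (Suc l) - fps_X ^ (k + l + 1)) / (1 - fps_X)"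
  proof (rule overlap_recurrence)
    show "D 0 = 0"
      by (simp add: D_def start_Suc_Int_end_Suc_0 tree_gf_desc_end)
    fix k
    let ?R = "if Suc k \<le> l then {right_comb (Suc l)} else {}"
    have "desc_start (Suc (Suc k)) \<inter> desc_end (Suc l) =
        nodes {Leaf} (desc_start (Suc k) \<inter> desc_end (Suc l)) \<union> ?R"
      by (rule btree_set_eqI) (auto simp: Node_in_desc_start Node_in_desc_end)
    also have "tree_gf \<dots> =
        tree_gf (nodes {Leaf} (desc_start (Suc k) \<inter> desc_end (Suc l))) + tree_gf ?R"
      by (rule tree_gf_Un) auto
    finally show "D (Suc k) = fps_X * D k + (if Suc k \<le> l then fps_X ^ Suc l else 0)"
      by (simp add: D_def tree_gf_nodes algebra_simps)
  qed
  then show ?thesis by (simp add: D_def algebra_simps)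
qed

text \<open>
  The local rule behind the fourth formula. For \<open>l > 0\<close> it is the telescoped recurrence with the
  known series for a single prefix or suffix inserted; for \<open>l = 0\<close> all terms are known series.
\<close>

lemma tree_gf_asc_desc_rec:
  "tree_gf (asc_start (Suc k) \<inter> desc_end (Suc l)) =
     fps_X * tree_gf (asc_start (Suc k) \<inter> desc_end l) +
     fps_X * tree_gf (asc_start k \<inter> desc_end (Suc l)) +
     (catalan_gf - 1) * (fps_X * catalan_gf) ^ (k + l + 2) +
     (if k = 0 \<and> l = 0 then fps_X else 0)"
proof (cases l)
  case 0
  show ?thesis
  proof (cases k)
    case 0
    have "fps_X * catalan_gf ^ 2 =
        fps_X * (fps_X * catalan_gf ^ 2) + fps_X * (catalan_gf - 1) +
        (catalan_gf - 1) * (fps_X * catalan_gf) ^ 2 + fps_X"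
      using catalan_gf_functional by algebra
    moreover have "tree_gf (asc_start (Suc 0)) = fps_X * catalan_gf ^ 2"
      unfolding tree_gf_asc_start by (simp add: power2_eq_square)
    moreover have "tree_gf (desc_end (Suc 0)) = catalan_gf - 1"
      by (simp add: start_end_1 tree_gf_nonempty)
    ultimately show ?thesis
      by (simp add: \<open>l = 0\<close> 0 start_Suc_Int_end_Suc_0 power2_eq_square)
  next
    case (Suc j)
    define p where "p = fps_X ^ j * catalan_gf ^ j"
    have p: "(fps_X * catalan_gf) ^ (Suc j + 0 + 2) = p * fps_X ^ 3 * catalan_gf ^ 3"
      "fps_X ^ Suc j * catalan_gf ^ (Suc j + 1) = p * fps_X * catalan_gf ^ 2"
      "fps_X ^ Suc (Suc j) * catalan_gf ^ (Suc (Suc j) + 1) = p * fps_X ^ 2 * catalan_gf ^ 3"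
      by (simp_all add: p_def power_add power2_eq_square power3_eq_cube power_mult_distrib mult_ac)
    have "p * fps_X ^ 2 * catalan_gf ^ 3 =
       fps_X * (p * fps_X ^ 2 * catalan_gf ^ 3) + fps_X * (p * fps_X * catalan_gf ^ 2) +
       (catalan_gf - 1) * (p * fps_X ^ 3 * catalan_gf ^ 3)"
      using catalan_gf_functional by algebra
    then show ?thesis
      unfolding \<open>l = 0\<close> Suc start_Suc_Int_end_Suc_0 start_end_0 Int_UNIV_right tree_gf_asc_start p
      by simp
  qed
next
  case (Suc j)
  have p: "fps_X * (fps_X ^ k * catalan_gf ^ (k + 1)) *
      (fps_X ^ Suc (Suc j) * catalan_gf ^ (Suc (Suc j) + 1) -
       fps_X * (fps_X ^ Suc j * catalan_gf ^ (Suc j + 1))) =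
      (catalan_gf - 1) * (fps_X * catalan_gf) ^ (k + Suc j + 2)"
    by (simp add: power_add power2_eq_square power_mult_distrib algebra_simps)
  show ?thesis
    unfolding Suc tree_gf_asc_desc_telescoped[of k j] tree_gf_asc_start[of k] tree_gf_desc_end p
    by simp
qed

section \<open>From permutations to trees\<close>

lemma avoids_2_13_iff_word_avoids:
  "avoids_2_13 n p \<longleftrightarrow> word_avoids (map p [1..<Suc n])"
proof -
  have "(\<exists>a b. 1 \<le> a \<and> a < b \<and> b + 1 \<le> n \<and> p b < p a \<and> p a < p (b + 1)) \<longleftrightarrow>
      (\<exists>i j. i < j \<and> Suc j < n \<and> p (Suc j) < p (Suc i) \<and> p (Suc i) < p (Suc (Suc j)))"
  proof safe
    fix a b assume "1 \<le> a" "a < b" "b + 1 \<le> n" "p b < p a" "p a < p (b + 1)"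
    then show "\<exists>i j. i < j \<and> Suc j < n \<and> p (Suc j) < p (Suc i) \<and> p (Suc i) < p (Suc (Suc j))"
      by (intro exI[of _ "a - 1"] exI[of _ "b - 1"]) auto
  next
    fix i j assume "i < j" "Suc j < n" "p (Suc j) < p (Suc i)" "p (Suc i) < p (Suc (Suc j))"
    then show "\<exists>a b. 1 \<le> a \<and> a < b \<and> b + 1 \<le> n \<and> p b < p a \<and> p a < p (b + 1)"
      by (intro exI[of _ "Suc i"] exI[of _ "Suc j"]) auto
  qed
  then show ?thesis
    unfolding avoids_2_13_def word_avoids_iff_nth by (auto simp del: upt_Suc)
qed

lemma bij_betw_permutes_lists:
  "bij_betw (\<lambda>p. map p [1..<Suc n]) {p. p permutes {1..n} \<and> P (map p [1..<Suc n])}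
     {xs. length xs = n \<and> distinct xs \<and> set xs = {1..n} \<and> P xs}"
  (is "bij_betw ?f ?A ?B")
proof (rule bij_betwI')
  fix p q assume p: "p \<in> ?A" and q: "q \<in> ?A"
  show "?f p = ?f q \<longleftrightarrow> p = q"
  proof
    assume eq: "?f p = ?f q"
    show "p = q"
    proof
      fix i
      show "p i = q i"
      proof (cases "i \<in> {1..n}")
        case True
        then show ?thesis using eq by (simp del: upt_Suc)
      next
        case False
        then have "p i = i" "q i = i"
          using p q permutes_not_in[of p "{1..n}"] permutes_not_in[of q "{1..n}"] by blast+
        then show ?thesis by simp
      qed
    qed
  qed simp
next
  fix p assume "p \<in> ?A"
  then have p: "p permutes {1..n}" "P (?f p)" by auto
  have "distinct (?f p)"
    using permutes_inj_on[OF p(1)] by (simp add: distinct_map del: upt_Suc)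
  moreover have "set (?f p) = {1..n}"
    using permutes_image[OF p(1)]
    by (simp add: atLeastLessThanSuc_atLeastAtMost del: upt_Suc)
  ultimately show "?f p \<in> ?B" using p(2) by (simp del: upt_Suc)
next
  fix xs assume "xs \<in> ?B"
  then have xs: "length xs = n" "distinct xs" "set xs = {1..n}" "P xs" by auto
  define p where "p i = (if i \<in> {1..n} then xs ! (i - 1) else i)" for i
  have f: "?f p = xs"
    by (rule nth_equalityI) (auto simp: p_def xs(1) simp del: upt_Suc)
  have "bij_betw p {1..n} {1..n}"
  proof -
    have "p ` {1..n} = {1..n}"
      using arg_cong[OF f, of set] xs(3)
      by (simp add: atLeastLessThanSuc_atLeastAtMost del: upt_Suc)
    moreover have "inj_on p {1..n}"
      using xs(2) unfolding f[symmetric]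
      by (simp add: distinct_map atLeastLessThanSuc_atLeastAtMost del: upt_Suc)
    ultimately show ?thesis by (simp add: bij_betw_def)
  qed
  then have "p permutes {1..n}"
    by (rule bij_imp_permutes) (auto simp: p_def)
  with f xs(4) show "\<exists>p\<in>?A. xs = ?f p" by auto
qed

lemma bij_betw_trees_words:
  "bij_betw (word 0) {t. size t = n \<and> P (word 0 t)}
     {xs. length xs = n \<and> distinct xs \<and> set xs = {1..n} \<and> word_avoids xs \<and> P xs}"
  (is "bij_betw _ ?A ?B")
proof (rule bij_betwI')
  fix t t' show "word 0 t = word 0 t' \<longleftrightarrow> t = t'" using word_inject by blast
next
  fix t assume "t \<in> ?A"
  then show "word 0 t \<in> ?B" by (auto simp: distinct_word set_word word_avoids_word)
next
  fix xs assume xs: "xs \<in> ?B"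
  then obtain t where "word 0 t = xs" using word_surj[of xs 0] by auto
  with xs show "\<exists>t\<in>?A. xs = word 0 t" using length_word[of 0 t] by auto
qed

text \<open>
  The single leaf is removed because \<open>perm_gf\<close> leaves out the empty permutation.
\<close>

lemma perm_gf_eq_tree_gf:
  assumes "\<And>n p. q n p \<longleftrightarrow> Q (map p [1..<Suc n])" "\<And>n p. r n p \<longleftrightarrow> R (map p [1..<Suc n])"
  shows "perm_gf avoids_2_13 q r = tree_gf ({t. Q (word 0 t)} \<inter> {t. R (word 0 t)} - {Leaf})"
proof (rule fps_ext)
  fix n
  let ?T = "{t. Q (word 0 t)} \<inter> {t. R (word 0 t)} - {Leaf}"
  show "perm_gf avoids_2_13 q r $ n = tree_gf ?T $ n"
  proof (cases "n = 0")
    case True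
    have "{t \<in> ?T. size t = 0} = {}" by auto
    with True show ?thesis by (simp only: perm_gf_def tree_gf_def) simp
  next
    case False
    have "perm_count avoids_2_13 q r n =
        card {xs. length xs = n \<and> distinct xs \<and> set xs = {1..n} \<and> word_avoids xs \<and> Q xs \<and> R xs}"
      unfolding perm_count_def avoids_2_13_iff_word_avoids assms
      by (rule bij_betw_same_card[OF bij_betw_permutes_lists])
    also have "\<dots> = card {t. size t = n \<and> Q (word 0 t) \<and> R (word 0 t)}"
      by (rule bij_betw_same_card[OF bij_betw_trees_words, symmetric])
    also have "{t. size t = n \<and> Q (word 0 t) \<and> R (word 0 t)} = {t \<in> ?T. size t = n}"
      using False by auto
    finally show ?thesis using False by (simp add: perm_gf_def tree_gf_def)
  qed
qed

lemma begins_ends_iff_runs: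
  "begins_incr k n p \<longleftrightarrow> prefix_run (<) k (map p [1..<Suc n])"
  "begins_decr k n p \<longleftrightarrow> prefix_run (>) k (map p [1..<Suc n])"
  "ends_incr l n p \<longleftrightarrow> suffix_run (<) l (map p [1..<Suc n])"
  "ends_decr l n p \<longleftrightarrow> suffix_run (>) l (map p [1..<Suc n])"
  unfolding begins_incr_def begins_decr_def ends_incr_def ends_decr_def
    prefix_run_map_upt suffix_run_map_upt by (rule refl)+

lemma perm_gf_2_13:
  "perm_gf avoids_2_13 (begins_incr k) (ends_incr l) = tree_gf (asc_start k \<inter> asc_end l - {Leaf})"
  "perm_gf avoids_2_13 (begins_decr k) (ends_incr l) = tree_gf (desc_start k \<inter> asc_end l - {Leaf})"
  "perm_gf avoids_2_13 (begins_decr k) (ends_decr l) = tree_gf (desc_start k \<inter> desc_end l - {Leaf})"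
  "perm_gf avoids_2_13 (begins_incr k) (ends_decr l) = tree_gf (asc_start k \<inter> desc_end l - {Leaf})"
  unfolding asc_start_def desc_start_def asc_end_def desc_end_def
  by (rule perm_gf_eq_tree_gf; rule begins_ends_iff_runs)+

section \<open>The trivariate series\<close>

lemma fps_xyz_eqI: "(\<And>k l. f $ k $ l = g $ k $ l) \<Longrightarrow> f = (g :: fps_xyz)"
  by (rule fps_ext, rule fps_ext)

lemma in_x_simps:
  "in_x (f + g) = in_x f + in_x g" "in_x (f - g) = in_x f - in_x g"
  "in_x (f * g) = in_x f * in_x g" "in_x 1 = 1"
  by (simp_all add: in_x_def)

lemma fps_xyz_nth:
  fixes F :: fps_xyz
  shows "in_x f $ k $ l = (if k = 0 \<and> l = 0 then f else 0)"
    and "(in_x f * F) $ k $ l = f * F $ k $ l"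
    and "(var_y * F) $ k $ l = (if k = 0 then 0 else F $ (k - 1) $ l)"
    and "(var_z * F) $ k $ l = (if l = 0 then 0 else F $ k $ (l - 1))"
  by (simp_all add: in_x_def var_y_def var_z_def)

text \<open>
  The recurrence at all coefficients, including the borders \<open>k = 0\<close> and \<open>l = 0\<close>. The corner
  \<open>k = l = 0\<close> is the only place where the empty tree has to be subtracted.
\<close>

lemma perm_gf_xyz_nth_rec:
  fixes k l :: nat
  defines "g \<equiv> \<lambda>k l. perm_gf_xyz avoids_2_13 $ k $ l"
  shows "g k l = (if k = 0 then 0 else fps_X * g (k - 1) l) +
     (if l = 0 then 0 else fps_X * g k (l - 1)) +
     (if (k, l) \<in> {(1, 0), (0, 1), (1, 1)} then fps_X else 0) +
     (catalan_gf - 1) * (fps_X * catalan_gf) ^ (k + l)"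
proof -
  have g: "g i j = tree_gf (asc_start i \<inter> desc_end j) - (if i = 0 \<and> j = 0 then 1 else 0)" for i j
  proof -
    have "asc_start i \<inter> desc_end j - {Leaf} = asc_start i \<inter> desc_end j" if "i \<noteq> 0 \<or> j \<noteq> 0"
      using that by auto
    then show ?thesis
      using tree_gf_nonempty
      by (auto simp: g_def perm_gf_xyz_def perm_gf_2_13 tree_gf_UNIV Compl_eq_Diff_UNIV)
  qed
  have border: "fps_X ^ Suc n * catalan_gf ^ (Suc n + 1) =
      fps_X * (fps_X ^ n * catalan_gf ^ (n + 1)) +
      (catalan_gf - 1) * (fps_X * catalan_gf) ^ Suc n" for n
    by (simp add: power_mult_distrib algebra_simps)
  consider "k = 0" "l = 0" | j where "k = Suc j" "l = 0" | j where "k = 0" "l = Suc j"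
    | i j where "k = Suc i" "l = Suc j"
    by (metis not0_implies_Suc)
  then show ?thesis
  proof cases
    case 1
    then show ?thesis by (simp add: g tree_gf_UNIV)
  next
    case 2
    then show ?thesis using border[of j]
      by (simp add: g tree_gf_asc_start del: power_Suc) (simp add: algebra_simps)
  next
    case 3
    then show ?thesis using border[of j]
      by (simp add: g tree_gf_desc_end del: power_Suc) (simp add: algebra_simps)
  next
    case 4
    then show ?thesis using tree_gf_asc_desc_rec[of i j]
      by (simp add: g del: power_Suc)
  qed
qed

lemma geometric_yz:
  fixes c d :: "rat fps"
  defines "V \<equiv> Abs_fps (\<lambda>k. Abs_fps (\<lambda>l. d * c ^ (k + l)))"
  shows "V * ((1 - var_y * in_x c) * (1 - var_z * in_x c)) = in_x d"
proof -
  have "V * (1 - var_y * in_x c) = V - var_y * (in_x c * V)"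
    by (simp add: algebra_simps)
  also have "\<dots> = Abs_fps (\<lambda>k. if k = 0 then Abs_fps (\<lambda>l. d * c ^ l) else 0)" (is "_ = ?U")
  proof (rule fps_xyz_eqI)
    fix k l
    show "(V - var_y * (in_x c * V)) $ k $ l = ?U $ k $ l"
      unfolding fps_sub_nth fps_xyz_nth by (cases k) (simp_all add: V_def mult_ac)
  qed
  finally have U: "V * (1 - var_y * in_x c) = ?U" .
  have "V * ((1 - var_y * in_x c) * (1 - var_z * in_x c)) = ?U * (1 - var_z * in_x c)"
    by (simp add: U[symmetric] mult.assoc)
  also have "\<dots> = ?U - var_z * (in_x c * ?U)"
    by (simp add: algebra_simps)
  also have "\<dots> = in_x d"
  proof (rule fps_xyz_eqI)
    fix k l
    show "(?U - var_z * (in_x c * ?U)) $ k $ l = in_x d $ k $ l"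
      unfolding fps_sub_nth fps_xyz_nth by (cases l) (simp_all add: mult_ac)
  qed
  finally show ?thesis .
qed

text \<open>
  Multiplying by \<open>1 - x (y + z)\<close> turns the coefficient recurrence into \<open>G (1 - x (y + z)) = P + V\<close>,
  where \<open>V\<close> is the double geometric series that the inner quotient denotes. Both quotients are
  genuine, as their denominators have constant term \<open>1\<close>.
\<close>

lemma perm_gf_xyz_closed_form:
  "perm_gf_xyz avoids_2_13 =
     1 / (1 - var_x * (var_y + var_z)) *
       (var_x * (var_y + var_z + var_y * var_z)
         + (in_x catalan_gf - 1) /
           ((1 - var_x * var_y * in_x catalan_gf) * (1 - var_x * var_z * in_x catalan_gf)))"
proof -
  let ?G = "perm_gf_xyz avoids_2_13"
  let ?A = "1 - var_x * (var_y + var_z)"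
  let ?D = "(1 - var_x * var_y * in_x catalan_gf) * (1 - var_x * var_z * in_x catalan_gf)"
  let ?Q = "in_x catalan_gf - 1"
  let ?P = "var_x * (var_y + var_z + var_y * var_z)"
  define V :: fps_xyz where
    "V = Abs_fps (\<lambda>k. Abs_fps (\<lambda>l. (catalan_gf - 1) * (fps_X * catalan_gf) ^ (k + l)))"
  have A0: "?A $ 0 $ 0 $ 0 \<noteq> 0"
    by (simp add: var_x_def in_x_def var_y_def var_z_def)
  have D0: "?D $ 0 $ 0 $ 0 \<noteq> 0"
    by (simp add: var_x_def in_x_def var_y_def var_z_def)
  have D: "?D = (1 - var_y * in_x (fps_X * catalan_gf)) * (1 - var_z * in_x (fps_X * catalan_gf))"
    by (simp add: in_x_simps var_x_def mult_ac)
  have VD: "V * ?D = ?Q"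
    unfolding D V_def geometric_yz by (simp add: in_x_simps)
  have "?D \<noteq> 0" using D0 by (metis fps_zero_nth)
  moreover have "?Q / ?D * ?D = V * ?D"
    unfolding VD by (rule fps_xyz_divide_mult_cancel[OF D0])
  ultimately have QD: "?Q / ?D = V" by simp
  have "?A * ?G = ?G - var_y * (in_x fps_X * ?G) - var_z * (in_x fps_X * ?G)"
    by (simp add: var_x_def algebra_simps)
  also have "\<dots> = ?P + V"
  proof (rule fps_xyz_eqI)
    fix k l
    have P: "?P = var_y * in_x fps_X + var_z * in_x fps_X + var_y * (var_z * in_x fps_X)"
      by (simp add: var_x_def algebra_simps)
    show "(?G - var_y * (in_x fps_X * ?G) - var_z * (in_x fps_X * ?G)) $ k $ l = (?P + V) $ k $ l"
      using perm_gf_xyz_nth_rec[of k l]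
      by (simp only: P fps_add_nth fps_sub_nth fps_xyz_nth) (auto simp: V_def)
  qed
  finally have "1 / ?A * (?P + V) = 1 / ?A * ?A * ?G"
    by (simp add: mult.assoc)
  also have "1 / ?A * ?A = 1"
    by (rule fps_xyz_divide_mult_cancel[OF A0])
  finally show ?thesis unfolding QD by simp
qed

section \<open>The four formulas\<close>

theorem proposition19:
  shows
    "(\<forall>k l m :: nat. k \<ge> 1 \<longrightarrow> l \<ge> 1 \<longrightarrow> m = max k l \<longrightarrow>
        perm_gf avoids_2_13 (begins_incr k) (ends_incr l) =
          fps_X ^ (k + l - 1) * catalan_gf ^ (k + 1)
            + (fps_X ^ m - fps_X ^ (k + l - 1)) / (1 - fps_X)
      \<and> perm_gf avoids_2_13 (begins_decr k) (ends_incr l) =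
          fps_X ^ (k + l - 1) * catalan_gf ^ 2
      \<and> perm_gf avoids_2_13 (begins_decr k) (ends_decr l) =
          fps_X ^ (k + l - 1) * catalan_gf ^ (l + 1)
            + (fps_X ^ m - fps_X ^ (k + l - 1)) / (1 - fps_X))
   \<and> perm_gf_xyz avoids_2_13 =
       1 / (1 - var_x * (var_y + var_z)) *
         (var_x * (var_y + var_z + var_y * var_z)
           + (in_x catalan_gf - 1) /
             ((1 - var_x * var_y * in_x catalan_gf) * (1 - var_x * var_z * in_x catalan_gf)))"
proof (intro conjI allI impI)
  fix k l m :: nat assume "1 \<le> k" "1 \<le> l" "m = max k l"
  then obtain i j where ij: "k = Suc i" "l = Suc j" and m: "m = max (Suc i) (Suc j)"
    by (cases k; cases l) auto
  have exps: "Suc i + Suc j - 1 = i + j + 1" "Suc i + 1 = i + 2" "Suc j + 1 = j + 2" by simp_all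
  have Leaf: "A (Suc i) \<inter> B (Suc j) - {Leaf} = A (Suc i) \<inter> B (Suc j)"
    if "Leaf \<notin> A (Suc i)" for A B :: "nat \<Rightarrow> btree set"
    using that by auto
  show "perm_gf avoids_2_13 (begins_incr k) (ends_incr l) =
      fps_X ^ (k + l - 1) * catalan_gf ^ (k + 1)
        + (fps_X ^ m - fps_X ^ (k + l - 1)) / (1 - fps_X)"
    unfolding ij m exps by (simp add: perm_gf_2_13 Leaf tree_gf_asc_asc)
  show "perm_gf avoids_2_13 (begins_decr k) (ends_incr l) =
      fps_X ^ (k + l - 1) * catalan_gf ^ 2"
    unfolding ij m exps by (simp add: perm_gf_2_13 Leaf tree_gf_desc_asc)
  show "perm_gf avoids_2_13 (begins_decr k) (ends_decr l) =
      fps_X ^ (k + l - 1) * catalan_gf ^ (l + 1)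
        + (fps_X ^ m - fps_X ^ (k + l - 1)) / (1 - fps_X)"
    unfolding ij m exps by (simp add: perm_gf_2_13 Leaf tree_gf_desc_desc)
qed (rule perm_gf_xyz_closed_form)

end
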